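(* Let $D$ be a (finite or infinite) digraph that contains at least one non-empty finite dicut, and let $\mathfrak{B}_{\min}$ denote the set of all non-empty dicuts of $D$ of minimum size (among all non-empty dicuts of $D$). Then the size of a smallest non-empty dicut of $D$ is equal to the size of a largest set of pairwise disjoint $\mathfrak{B}_{\min}$-dijoins of $D$.
   Context: Digraphs may have parallel edges, but no loops. For disjoint sets $X,Y$ with $X\cup Y=V(D)$, $E_D(X,Y)$ is the set of edges with one endvertex in $X$ and the other in $Y$. A cut of $D$ is a set $B=E_D(X,Y)$ where $X,Y$ are non-empty, disjoint and have union $V(D)$. A dicut is a cut $B=E_D(X,Y)$ such that all edges of $B$ have their heads in the same one of the two sides $X,Y$. For a set $\mathfrak{B}$ of dicuts of $D$, a $\mathfrak{B}$-dijoin is a set of edges of $D$ meeting every dicut in $\mathfrak{B}$. *)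

theory Defs
  imports "Graph_Theory.Digraph" "HOL-Library.Equipollence"
begin

text \<open>
  A digraph with parallel edges allowed, loops forbidden, and no finiteness assumption is a
  \<^locale>\<open>loopfree_digraph\<close>. Sizes of possibly infinite sets are compared by
  \<open>\<lesssim>\<close> and \<open>\<approx>\<close>, i.e. by cardinality.
\<close>

definition vertex_bipartition :: "('v, 'e) pre_digraph \<Rightarrow> 'v set \<Rightarrow> 'v set \<Rightarrow> bool" where
  "vertex_bipartition D X Y \<longleftrightarrow> X \<noteq> {} \<and> Y \<noteq> {} \<and> X \<inter> Y = {} \<and> X \<union> Y = verts D"

definition edges_between :: "('v, 'e) pre_digraph \<Rightarrow> 'v set \<Rightarrow> 'v set \<Rightarrow> 'e set" where
  "edges_between D X Y =
     {e \<in> arcs D. tail D e \<in> X \<and> head D e \<in> Y \<or> tail D e \<in> Y \<and> head D e \<in> X}"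

definition dicut :: "('v, 'e) pre_digraph \<Rightarrow> 'e set \<Rightarrow> bool" where
  "dicut D B \<longleftrightarrow>
     (\<exists>X Y. vertex_bipartition D X Y \<and> B = edges_between D X Y \<and>
        ((\<forall>e\<in>B. head D e \<in> X) \<or> (\<forall>e\<in>B. head D e \<in> Y)))"

definition dijoin :: "('v, 'e) pre_digraph \<Rightarrow> 'e set set \<Rightarrow> 'e set \<Rightarrow> bool" where
  "dijoin D \<BB> J \<longleftrightarrow> J \<subseteq> arcs D \<and> (\<forall>B\<in>\<BB>. J \<inter> B \<noteq> {})"

definition min_dicuts :: "('v, 'e) pre_digraph \<Rightarrow> 'e set set" where
  "min_dicuts D =
     {B. dicut D B \<and> B \<noteq> {} \<and> (\<forall>B'. dicut D B' \<and> B' \<noteq> {} \<longrightarrow> B \<lesssim> B')}"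

definition disjoint_dijoins :: "('v, 'e) pre_digraph \<Rightarrow> 'e set set \<Rightarrow> 'e set set \<Rightarrow> bool" where
  "disjoint_dijoins D \<BB> \<J> \<longleftrightarrow> (\<forall>J\<in>\<J>. dijoin D \<BB> J) \<and> pairwise disjnt \<J>"

definition largest_disjoint_dijoins ::
    "('v, 'e) pre_digraph \<Rightarrow> 'e set set \<Rightarrow> 'e set set \<Rightarrow> bool" where
  "largest_disjoint_dijoins D \<BB> \<J> \<longleftrightarrow>
     disjoint_dijoins D \<BB> \<J> \<and> (\<forall>\<J>'. disjoint_dijoins D \<BB> \<J>' \<longrightarrow> \<J>' \<lesssim> \<J>)"

end

theory Submission
  imports Defs "HOL-Analysis.Function_Topology"
begin

text \<open>
  Let \<open>k\<close> be the size of a smallest non-empty dicut. Disjoint dijoins pick distinct arcs from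
  any one minimum dicut, so there are at most \<open>k\<close> of them. Conversely, \<open>k\<close> disjoint dijoins
  amount to a colouring of the arcs with \<open>k\<close> colours in which every minimum dicut is
  \<^emph>\<open>rainbow\<close>, that is, sees every colour exactly once; the colour classes are then the dijoins.

  A non-empty dicut is the set of arcs entering a set \<open>X\<close> that no arc leaves (an absorbing set).
  For a finite digraph the colouring is built by induction. Suppose that \<open>X\<close> is absorbing,
  its entering arcs form a minimum dicut, and neither \<open>X\<close> nor its complement is a
  single vertex. Contract \<open>X\<close>, contract the complement of \<open>X\<close>, colour both quotients,
  and permute the colours of one so that the colourings agree on the dicut of \<open>X\<close>
  (\<open>glue_colourings\<close>). Minimum dicuts whose shore is nested with \<open>X\<close> survive
  in one of the quotients and are rainbow. If the shore \<open>Y\<close> crosses \<open>X\<close>, then counting arcs of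
  a fixed colour is modular on absorbing sets. Either both \<open>X \<inter> Y\<close> and \<open>X \<union> Y\<close> define minimum
  dicuts, which are rainbow, and hence so is that of \<open>Y\<close>; or one of them has no entering arc, and
  the dicut of \<open>Y\<close> has another shore that is nested with \<open>X\<close> (\<open>rainbow_on_crossing\<close>).

  If no such \<open>X\<close> exists, every minimum dicut is the set of all arcs at a sink or at a source.
  Sinks have pairwise disjoint dicuts, and so have sources, so a rainbow colouring is
  an edge colouring of a bipartite multigraph of maximum degree at most \<open>k\<close>,
  which exists by Koenig's theorem (\<open>koenig_edge_colouring\<close>).

  In an infinite digraph, finitely many minimum dicuts only distinguish finitely many classes of
  vertices, so the finite argument applies to the quotient by these classes. Since minimum
  dicuts are finite, Tychonoff's theorem yields a colouring that is good for all of them at once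
  (\<open>colouring_compactness\<close>). Quotients are not formed explicitly: a quotient is represented by the
  finite algebra of those vertex sets that are unions of classes, and the induction is on
  this algebra.
\<close>

section \<open>Edge colourings of bipartite multigraphs\<close>

text \<open>
  An edge \<open>e\<close> has the end \<open>u e\<close> on one side of the bipartite multigraph and the end \<open>w e\<close> on the other.
\<close>

definition proper_colouring :: "('e \<Rightarrow> 'a) \<Rightarrow> ('e \<Rightarrow> 'b) \<Rightarrow> 'e set \<Rightarrow> ('e \<Rightarrow> nat) \<Rightarrow> bool" where
  "proper_colouring u w E c \<longleftrightarrow>
     (\<forall>e\<in>E. \<forall>f\<in>E. c e = c f \<longrightarrow> u e = u f \<or> w e = w f \<longrightarrow> e = f)"

text \<open>
  If \<open>c\<close> is proper and \<open>\<alpha>\<close> is missing at \<open>x\<close>, this is the maximal path from \<open>x\<close> whose edges are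
  alternately coloured \<open>\<beta>\<close> and \<open>\<alpha>\<close>. The rules
  traverse the path in one direction only: edges coloured \<open>\<beta>\<close> from their \<open>u\<close>-end to their
  \<open>w\<close>-end, edges coloured \<open>\<alpha>\<close> back. This orientation replaces the usual parity argument.
\<close>

inductive_set kempe_chain ::
    "('e \<Rightarrow> 'a) \<Rightarrow> ('e \<Rightarrow> 'b) \<Rightarrow> 'e set \<Rightarrow> ('e \<Rightarrow> nat) \<Rightarrow> nat \<Rightarrow> nat \<Rightarrow> 'a \<Rightarrow> 'e set"
  for u w E c \<alpha> \<beta> x where
  start: "\<lbrakk>f \<in> E; u f = x; c f = \<beta>\<rbrakk> \<Longrightarrow> f \<in> kempe_chain u w E c \<alpha> \<beta> x"
| via_w: "\<lbrakk>f \<in> kempe_chain u w E c \<alpha> \<beta> x; c f = \<beta>; g \<in> E; c g = \<alpha>; w g = w f\<rbrakk>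
            \<Longrightarrow> g \<in> kempe_chain u w E c \<alpha> \<beta> x"
| via_u: "\<lbrakk>g \<in> kempe_chain u w E c \<alpha> \<beta> x; c g = \<alpha>; f \<in> E; c f = \<beta>; u f = u g\<rbrakk>
            \<Longrightarrow> f \<in> kempe_chain u w E c \<alpha> \<beta> x"

text \<open>
  Exchanging \<open>\<alpha>\<close> and \<open>\<beta>\<close> along the chain from \<open>x\<close> frees \<open>\<beta>\<close> at \<open>x\<close>, since \<open>\<alpha>\<close> is missing there. It
  creates no edge coloured \<open>\<beta>\<close> at \<open>y\<close>: the chain can reach an edge coloured \<open>\<alpha>\<close> at \<open>y\<close> only through an
  edge coloured \<open>\<beta>\<close> at \<open>y\<close>.
\<close>

lemma kempe_chain_swap:
  fixes c :: "'e \<Rightarrow> nat"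
  assumes proper: "proper_colouring u w E c" and range: "c ` E \<subseteq> {..<k}"
    and \<alpha>: "\<alpha> < k" "\<forall>f\<in>E. u f = x \<longrightarrow> c f \<noteq> \<alpha>"
    and \<beta>: "\<beta> < k" "\<forall>f\<in>E. w f = y \<longrightarrow> c f \<noteq> \<beta>"
  shows "\<exists>c'. proper_colouring u w E c' \<and> c' ` E \<subseteq> {..<k} \<and>
           (\<forall>f\<in>E. u f = x \<or> w f = y \<longrightarrow> c' f \<noteq> \<beta>)"
proof (cases "\<alpha> = \<beta>")
  case True
  then show ?thesis using assms by blast
next
  case False
  define C where "C = kempe_chain u w E c \<alpha> \<beta> x"
  define c' where "c' f = (if f \<in> C then if c f = \<alpha> then \<beta> else \<alpha> else c f)" for f
  have P: "e = f" if "e \<in> E" "f \<in> E" "c e = c f" "u e = u f \<or> w e = w f" for e f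
    using proper that unfolding proper_colouring_def by blast
  have C: "f \<in> E" "c f = \<alpha> \<or> c f = \<beta>" if "f \<in> C" for f
    using that unfolding C_def by (auto elim: kempe_chain.cases)
  have pred_u: "u f = x \<or> (\<exists>g\<in>C. c g = \<alpha> \<and> u g = u f)" if "f \<in> C" "c f = \<beta>" for f
    using that(1)[unfolded C_def] by cases (use that(2) False in \<open>auto simp: C_def\<close>)
  have pred_w: "\<exists>g\<in>C. c g = \<beta> \<and> w g = w f" if "f \<in> C" "c f = \<alpha>" for f
    using that(1)[unfolded C_def] by cases (use that(2) False in \<open>auto simp: C_def\<close>)
  \<comment> \<open>The chain is closed under adjacency in both directions: a neighbour against the direction of
    traversal has the same end and colour as the predecessor, hence is the predecessor.\<close>
  have adj: "f \<in> C"
    if e: "e \<in> C" and f: "f \<in> E" and cf: "c f = \<alpha> \<or> c f = \<beta>" "c f \<noteq> c e"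
      and inc: "u e = u f \<or> w e = w f" for e f
  proof (cases "c e = \<beta>")
    case True
    then have cfa: "c f = \<alpha>" using cf by auto
    show ?thesis
    proof (cases "w e = w f")
      case True
      then show ?thesis
        using e f cfa \<open>c e = \<beta>\<close> unfolding C_def by (metis kempe_chain.via_w)
    next
      case False
      then have "u e = u f" using inc by auto
      then obtain g where "g \<in> C" "c g = \<alpha>" "u g = u f"
        using pred_u[OF e \<open>c e = \<beta>\<close>] \<alpha>(2) f cfa by metis
      then show ?thesis using P[of g f] C f cfa by auto
    qed
  next
    case False
    then have cea: "c e = \<alpha>" and cfb: "c f = \<beta>" using C(2)[OF e] cf by auto
    show ?thesis
    proof (cases "u e = u f")
      case True
      then show ?thesis
        using e f cea cfb unfolding C_def by (metis kempe_chain.via_u)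
    next
      case False
      then have "w e = w f" using inc by auto
      then obtain g where "g \<in> C" "c g = \<beta>" "w g = w f"
        using pred_w[OF e cea] by metis
      then show ?thesis using P[of g f] C f cfb by auto
    qed
  qed
  have mixed: False
    if "e \<in> C" "f \<in> E" "f \<notin> C" "c' e = c' f" "u e = u f \<or> w e = w f" for e f
    using adj[of e f] that C[of e] False unfolding c'_def by (auto split: if_splits)
  have "proper_colouring u w E c'"
    unfolding proper_colouring_def
  proof (intro ballI impI)
    fix e f assume ef: "e \<in> E" "f \<in> E" "c' e = c' f" "u e = u f \<or> w e = w f"
    consider "e \<in> C" "f \<in> C" | "e \<in> C" "f \<notin> C" | "e \<notin> C" "f \<in> C" | "e \<notin> C" "f \<notin> C"
      by blast
    then show "e = f"
    proof cases
      case 1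
      then have "c e = c f"
        using ef(3) C(2)[of e] C(2)[of f] False by (auto simp: c'_def split: if_splits)
      then show ?thesis using P ef by blast
    next
      case 2
      then show ?thesis using mixed[of e f] ef by blast
    next
      case 3
      then show ?thesis using mixed[of f e] ef by (metis)
    next
      case 4
      then show ?thesis using P ef by (auto simp: c'_def)
    qed
  qed
  moreover have "c' ` E \<subseteq> {..<k}"
    using range \<alpha>(1) \<beta>(1) by (auto simp: c'_def)
  moreover have "c' f \<noteq> \<beta>" if f: "f \<in> E" "u f = x \<or> w f = y" for f
  proof
    assume *: "c' f = \<beta>"
    show False
    proof (cases "f \<in> C")
      case True
      then have "c f = \<alpha>" using * False by (auto simp: c'_def split: if_splits)
      with f \<alpha>(2) have "w f = y" by blast
      moreover obtain g where "g \<in> C" "c g = \<beta>" "w g = w f"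
        using pred_w[OF True \<open>c f = \<alpha>\<close>] by blast
      ultimately show False using \<beta>(2) C(1) by metis
    next
      case out: False
      then have "c f = \<beta>" using * by (auto simp: c'_def)
      then have "u f = x" using f \<beta>(2) by blast
      then show False
        using out f \<open>c f = \<beta>\<close> kempe_chain.start unfolding C_def by metis
    qed
  qed
  ultimately show ?thesis by blast
qed

lemma missing_colour:
  fixes c :: "'e \<Rightarrow> nat"
  assumes "finite E" "e \<notin> E" "card {f \<in> insert e E. u f = u e} \<le> k"
  shows "\<exists>\<alpha><k. \<forall>f\<in>E. u f = u e \<longrightarrow> c f \<noteq> \<alpha>"
proof (rule ccontr)
  assume "\<not> ?thesis"
  then have "{..<k} \<subseteq> c ` {f \<in> E. u f = u e}" by fastforce
  then have "k \<le> card (c ` {f \<in> E. u f = u e})"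
    using card_mono[of "c ` {f \<in> E. u f = u e}" "{..<k}"] assms(1) by simp
  also have "\<dots> \<le> card {f \<in> E. u f = u e}"
    using assms(1) by (intro card_image_le) simp
  finally have "k \<le> card {f \<in> E. u f = u e}" .
  moreover have "{f \<in> insert e E. u f = u e} = insert e {f \<in> E. u f = u e}" by auto
  ultimately show False using assms by simp
qed

text \<open>
  Edges are coloured one at a time. A new edge leaves some colour missing at each of its two ends
  (\<open>missing_colour\<close>); a Kempe swap makes the same colour missing at both.
\<close>

lemma koenig_edge_colouring:
  assumes "finite E" "\<forall>x. card {e \<in> E. u e = x} \<le> k" "\<forall>y. card {e \<in> E. w e = y} \<le> k"
  shows "\<exists>c. proper_colouring u w E c \<and> c ` E \<subseteq> {..<k}"
  using assms
proof (induction E rule: finite_induct)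
  case empty
  then show ?case by (simp add: proper_colouring_def)
next
  case (insert e E)
  have "card {f \<in> E. u f = x} \<le> k" for x
    by (rule le_trans[OF card_mono insert.prems(1)[rule_format, of x]])
      (use insert.hyps in auto)
  moreover have "card {f \<in> E. w f = y} \<le> k" for y
    by (rule le_trans[OF card_mono insert.prems(2)[rule_format, of y]])
      (use insert.hyps in auto)
  ultimately obtain c where c: "proper_colouring u w E c" "c ` E \<subseteq> {..<k}"
    using insert.IH by blast
  obtain \<alpha> where \<alpha>: "\<alpha> < k" "\<forall>f\<in>E. u f = u e \<longrightarrow> c f \<noteq> \<alpha>"
    using missing_colour[of E e u k c] insert by blast
  obtain \<beta> where \<beta>: "\<beta> < k" "\<forall>f\<in>E. w f = w e \<longrightarrow> c f \<noteq> \<beta>"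
    using missing_colour[of E e w k c] insert by blast
  obtain c' where c': "proper_colouring u w E c'" "c' ` E \<subseteq> {..<k}"
    "\<forall>f\<in>E. u f = u e \<or> w f = w e \<longrightarrow> c' f \<noteq> \<beta>"
    using kempe_chain_swap[OF c \<alpha> \<beta>] by blast
  have "proper_colouring u w (insert e E) (c'(e := \<beta>))"
    using c'(1,3) insert.hyps(2) unfolding proper_colouring_def by (auto simp: eq_commute)
  moreover have "(c'(e := \<beta>)) ` insert e E \<subseteq> {..<k}"
    using c'(2) \<beta>(1) by auto
  ultimately show ?case by blast
qed

text \<open>
  The members of the two families are the stars of a bipartite multigraph. An edge that lies in no
  member of a family gets a private end of degree one.
\<close>

lemma colouring_two_disjoint_families:
  fixes \<S> \<T> :: "'e set set"
  assumes fin: "finite \<S>" "finite \<T>" "\<And>B. B \<in> \<S> \<union> \<T> \<Longrightarrow> finite B"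
    and disj: "pairwise disjnt \<S>" "pairwise disjnt \<T>"
    and le: "\<And>B. B \<in> \<S> \<union> \<T> \<Longrightarrow> card B \<le> k" and "k > 0"
  shows "\<exists>c :: 'e \<Rightarrow> nat. range c \<subseteq> {..<k} \<and> (\<forall>B\<in>\<S> \<union> \<T>. inj_on c B)"
proof -
  define E where "E = \<Union>\<S> \<union> \<Union>\<T>"
  have "finite E" using fin by (auto simp: E_def)
  define block :: "'e set set \<Rightarrow> 'e \<Rightarrow> 'e set" where
    "block \<F> e = insert e (\<Union>{B \<in> \<F>. e \<in> B})" for \<F> e
  have block: "block \<F> e = B" if "pairwise disjnt \<F>" "B \<in> \<F>" "e \<in> B" for \<F> e B
    using that unfolding block_def pairwise_def disjnt_def by blast
  have fibre: "card {e \<in> E. block \<F> e = x} \<le> k"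
    if \<F>: "pairwise disjnt \<F>" "\<F> \<subseteq> \<S> \<union> \<T>" for \<F> x
  proof -
    have sub: "{e \<in> E. block \<F> e = x} \<subseteq> x" unfolding block_def by blast
    show ?thesis
    proof (cases "x \<in> \<F>")
      case True
      then show ?thesis
        using sub fin(3)[of x] le[of x] card_mono \<F>(2) by (meson le_trans subsetD)
    next
      case False
      have "x = {e}" if "block \<F> e = x" for e
        using False block[OF \<F>(1), of _ e] that unfolding block_def by fastforce
      then have "\<forall>e\<in>{e \<in> E. block \<F> e = x}. \<forall>f\<in>{e \<in> E. block \<F> e = x}. e = f"
        by blast
      then have "card {e \<in> E. block \<F> e = x} \<le> Suc 0"
        using card_le_Suc0_iff_eq[of "{e \<in> E. block \<F> e = x}"] \<open>finite E\<close> by simp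
      then show ?thesis using \<open>k > 0\<close> by simp
    qed
  qed
  obtain c where c: "proper_colouring (block \<S>) (block \<T>) E c" "c ` E \<subseteq> {..<k}"
    using koenig_edge_colouring[of E "block \<S>" k "block \<T>"] fibre disj \<open>finite E\<close> by blast
  define c' where "c' e = (if e \<in> E then c e else 0)" for e
  have "range c' \<subseteq> {..<k}" using c(2) \<open>k > 0\<close> by (auto simp: c'_def)
  moreover have "inj_on c' B" if B: "B \<in> \<S> \<union> \<T>" for B
  proof (rule inj_onI)
    fix e f assume ef: "e \<in> B" "f \<in> B" "c' e = c' f"
    then have "e \<in> E" "f \<in> E" using B by (auto simp: E_def)
    moreover have "block \<S> e = block \<S> f \<or> block \<T> e = block \<T> f"
      using B block[OF disj(1)] block[OF disj(2)] ef by (metis UnE)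
    ultimately show "e = f"
      using c(1) ef(3) unfolding proper_colouring_def c'_def by auto
  qed
  ultimately show ?thesis by blast
qed

section \<open>Dicuts as sets of arcs entering an absorbing set\<close>

text \<open>
  Absorbing sets may contain points that are not vertices of \<open>D\<close>; these affect no entering arc, and
  complements can then be taken in the whole type.
\<close>

definition absorbing :: "('v, 'e) pre_digraph \<Rightarrow> 'v set \<Rightarrow> bool" where
  "absorbing D X \<longleftrightarrow> (\<forall>e\<in>arcs D. tail D e \<in> X \<longrightarrow> head D e \<in> X)"

definition entering :: "('v, 'e) pre_digraph \<Rightarrow> 'v set \<Rightarrow> 'e set" where
  "entering D X = {e \<in> arcs D. tail D e \<notin> X \<and> head D e \<in> X}"

text \<open>
  The side of a dicut that contains all heads is absorbing. Non-emptiness of the cut forces both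
  sides to be non-empty, which gives the converse.
\<close>

lemma nonempty_dicut_iff:
  assumes "wf_digraph D"
  shows "dicut D B \<and> B \<noteq> {} \<longleftrightarrow> (\<exists>X. absorbing D X \<and> B = entering D X \<and> B \<noteq> {})"
proof
  interpret wf_digraph D by fact
  have one_sided: "absorbing D X \<and> edges_between D X Y = entering D X"
    if "vertex_bipartition D X Y" "\<forall>e\<in>edges_between D X Y. head D e \<in> X" for X Y
    using that tail_in_verts head_in_verts
    unfolding vertex_bipartition_def edges_between_def absorbing_def entering_def by blast
  have sym: "vertex_bipartition D Y X" "edges_between D X Y = edges_between D Y X"
    if "vertex_bipartition D X Y" for X Y
    using that unfolding vertex_bipartition_def edges_between_def by blast+
  {
    assume "dicut D B \<and> B \<noteq> {}"
    then show "\<exists>X. absorbing D X \<and> B = entering D X \<and> B \<noteq> {}"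
      unfolding dicut_def using one_sided sym by metis
  next
    assume "\<exists>X. absorbing D X \<and> B = entering D X \<and> B \<noteq> {}"
    then obtain X where X: "absorbing D X" "B = entering D X" "B \<noteq> {}" by blast
    have "vertex_bipartition D (X \<inter> verts D) (verts D - X)"
      using X tail_in_verts head_in_verts unfolding vertex_bipartition_def entering_def by blast
    moreover have "B = edges_between D (X \<inter> verts D) (verts D - X)"
      using X tail_in_verts head_in_verts
      unfolding edges_between_def entering_def absorbing_def by blast
    moreover have "\<forall>e\<in>B. head D e \<in> X \<inter> verts D"
      using X head_in_verts unfolding entering_def by blast
    ultimately show "dicut D B \<and> B \<noteq> {}" using X(3) unfolding dicut_def by blast
  }
qed

lemma absorbing_Int: "absorbing D X \<Longrightarrow> absorbing D Y \<Longrightarrow> absorbing D (X \<inter> Y)"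
  and absorbing_Un: "absorbing D X \<Longrightarrow> absorbing D Y \<Longrightarrow> absorbing D (X \<union> Y)"
  unfolding absorbing_def by blast+

text \<open>
  No arc joins \<open>X - Y\<close> and \<open>Y - X\<close>, as it would leave \<open>X\<close> or \<open>Y\<close>. Submodularity of cuts therefore holds
  with equality, arc by arc, and so for the arcs of a fixed colour as well.
\<close>

lemma entering_uncross:
  assumes "absorbing D X" "absorbing D Y"
  shows "entering D (X \<inter> Y) \<union> entering D (X \<union> Y) = entering D X \<union> entering D Y"
    and "entering D (X \<inter> Y) \<inter> entering D (X \<union> Y) = entering D X \<inter> entering D Y"
  using assms unfolding absorbing_def entering_def by blast+

lemma card_entering_modular:
  assumes "absorbing D X" "absorbing D Y" "finite (entering D X)" "finite (entering D Y)"
  shows "card (entering D (X \<inter> Y) \<inter> S) + card (entering D (X \<union> Y) \<inter> S)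
       = card (entering D X \<inter> S) + card (entering D Y \<inter> S)"
proof -
  note eq = entering_uncross[OF assms(1,2)]
  have fin: "finite (entering D (X \<inter> Y))" "finite (entering D (X \<union> Y))"
    using eq(1) assms(3,4) by (metis finite_Un)+
  have "card (entering D (X \<inter> Y) \<inter> S) + card (entering D (X \<union> Y) \<inter> S)
      = card ((entering D (X \<inter> Y) \<inter> S) \<union> (entering D (X \<union> Y) \<inter> S))
      + card ((entering D (X \<inter> Y) \<inter> S) \<inter> (entering D (X \<union> Y) \<inter> S))"
    using fin by (intro card_Un_Int) auto
  also have "(entering D (X \<inter> Y) \<inter> S) \<union> (entering D (X \<union> Y) \<inter> S)
      = (entering D X \<inter> S) \<union> (entering D Y \<inter> S)" using eq by blast
  also have "(entering D (X \<inter> Y) \<inter> S) \<inter> (entering D (X \<union> Y) \<inter> S)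
      = (entering D X \<inter> S) \<inter> (entering D Y \<inter> S)" using eq by blast
  finally show ?thesis
    using assms(3,4) card_Un_Int[of "entering D X \<inter> S" "entering D Y \<inter> S"] by simp
qed

text \<open>
  If no arc enters \<open>X \<inter> Y\<close>, then this set is a union of weak components of the digraph, and removing it from \<open>Y\<close>
  yields the same dicut with a shore disjoint from \<open>X\<close>. Dually for \<open>X \<union> Y\<close>. In a weakly connected
  digraph these degenerate cases cannot occur for properly crossing shores.
\<close>

lemma detach_Int:
  assumes "absorbing D X" "absorbing D Y" "entering D (X \<inter> Y) = {}"
  shows "absorbing D (Y - X)" "entering D (Y - X) = entering D Y"
  using assms unfolding absorbing_def entering_def by blast+

lemma detach_Un:
  assumes "absorbing D X" "absorbing D Y" "entering D (X \<union> Y) = {}"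
  shows "absorbing D (Y \<union> - X)" "entering D (Y \<union> - X) = entering D Y"
  using assms unfolding absorbing_def entering_def by blast+

section \<open>Colourings for finitely many minimum dicuts\<close>

definition rainbow :: "nat \<Rightarrow> ('e \<Rightarrow> nat) \<Rightarrow> 'e set \<Rightarrow> bool" where
  "rainbow k c B \<longleftrightarrow> bij_betw c B {..<k}"

text \<open>
  This turns being rainbow into linear equations, to which modularity can be applied.
\<close>

lemma rainbow_iff_card_fibres:
  assumes "finite B" "card B = k"
  shows "rainbow k c B \<longleftrightarrow> (\<forall>i<k. card (B \<inter> c -` {i}) = 1)"
proof
  assume "rainbow k c B"
  then have bij: "inj_on c B" "c ` B = {..<k}" unfolding rainbow_def bij_betw_def by auto
  show "\<forall>i<k. card (B \<inter> c -` {i}) = 1"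
  proof (intro allI impI)
    fix i assume "i < k"
    then have "i \<in> c ` B" using bij(2) by simp
    then obtain b where "b \<in> B" "c b = i" by blast
    then have "B \<inter> c -` {i} = {b}" using bij(1) by (auto dest: inj_onD)
    then show "card (B \<inter> c -` {i}) = 1" by simp
  qed
next
  assume *: "\<forall>i<k. card (B \<inter> c -` {i}) = 1"
  have sub: "{..<k} \<subseteq> c ` B"
  proof
    fix i assume "i \<in> {..<k}"
    then have "card (B \<inter> c -` {i}) = 1" using * by simp
    then have "B \<inter> c -` {i} \<noteq> {}" by force
    then show "i \<in> c ` B" by blast
  qed
  moreover have "card (c ` B) \<le> k" using card_image_le assms by blast
  ultimately have "c ` B = {..<k}"
    using assms by (metis card_lessThan card_seteq finite_imageI)
  then show "rainbow k c B"
    unfolding rainbow_def bij_betw_def using assms by (simp add: eq_card_imp_inj_on)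
qed

lemma rainbow_of_inj_on:
  assumes "inj_on c B" "card B = k" "range c \<subseteq> {..<k}"
  shows "rainbow k c B"
proof -
  have "c ` B \<subseteq> {..<k}" using assms(3) by auto
  moreover have "card (c ` B) = k" using assms(1,2) card_image by blast
  ultimately show ?thesis
    unfolding rainbow_def bij_betw_def using assms(1) by (simp add: card_subset_eq)
qed

text \<open>
  A finite algebra of sets stands for the quotient whose vertices are the atoms of the algebra.
\<close>

definition set_algebra :: "'v set set \<Rightarrow> bool" where
  "set_algebra \<A> \<longleftrightarrow> (\<forall>X\<in>\<A>. - X \<in> \<A>) \<and> (\<forall>X\<in>\<A>. \<forall>Y\<in>\<A>. X \<inter> Y \<in> \<A>)"

text \<open>
  In the quotient, the contraction merges the atoms inside \<open>X\<close> into one: what remains are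
  the sets that do not cut through \<open>X\<close>.
\<close>

definition contract :: "'v set \<Rightarrow> 'v set set \<Rightarrow> 'v set set" where
  "contract X \<A> = {Y \<in> \<A>. X \<inter> Y = {} \<or> X \<subseteq> Y}"

lemma set_algebraD:
  assumes "set_algebra \<A>" "X \<in> \<A>"
  shows "- X \<in> \<A>" and "Y \<in> \<A> \<Longrightarrow> X \<inter> Y \<in> \<A>" and "Y \<in> \<A> \<Longrightarrow> X \<union> Y \<in> \<A>"
    and "Y \<in> \<A> \<Longrightarrow> X - Y \<in> \<A>"
proof -
  show a: "- X \<in> \<A>" and b: "Y \<in> \<A> \<Longrightarrow> X \<inter> Y \<in> \<A>"
    using assms unfolding set_algebra_def by auto
  show "X \<union> Y \<in> \<A>" if "Y \<in> \<A>"
  proof -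
    have "- (- X \<inter> - Y) \<in> \<A>" using assms that unfolding set_algebra_def by blast
    then show ?thesis by (simp add: Compl_Int)
  qed
  show "X - Y \<in> \<A>" if "Y \<in> \<A>"
    using assms that unfolding set_algebra_def Diff_eq by blast
qed

lemma set_algebra_contract:
  assumes "set_algebra \<A>"
  shows "set_algebra (contract X \<A>)"
proof -
  have "- Y \<in> contract X \<A>" if "Y \<in> contract X \<A>" for Y
    using that set_algebraD(1)[OF assms, of Y] unfolding contract_def by blast
  moreover have "Y \<inter> Z \<in> contract X \<A>" if "Y \<in> contract X \<A>" "Z \<in> contract X \<A>" for Y Z
    using that set_algebraD(2)[OF assms, of Y Z] unfolding contract_def by blast
  ultimately show ?thesis unfolding set_algebra_def by blast
qed

text \<open>
  The atoms are the classes of points that lie in the same members of \<open>\<F>\<close>.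
\<close>

lemma finite_set_algebra_containing:
  assumes "finite \<F>"
  shows "\<exists>\<A>. finite \<A> \<and> set_algebra \<A> \<and> \<F> \<subseteq> \<A>"
proof -
  define trace where "trace v = {X \<in> \<F>. v \<in> X}" for v
  define \<A> where "\<A> = (\<lambda>\<G>. trace -` \<G>) ` Pow (Pow \<F>)"
  have "finite \<A>" using assms by (simp add: \<A>_def)
  moreover have "set_algebra \<A>"
    unfolding set_algebra_def
  proof (intro conjI ballI)
    fix X assume "X \<in> \<A>"
    then obtain \<G> where "\<G> \<subseteq> Pow \<F>" "X = trace -` \<G>" unfolding \<A>_def by blast
    then have "- X = trace -` (Pow \<F> - \<G>)" by (auto simp: trace_def)
    then show "- X \<in> \<A>" unfolding \<A>_def by blast
  next
    fix X Y assume "X \<in> \<A>" "Y \<in> \<A>"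
    then obtain \<G> \<H> where "\<G> \<subseteq> Pow \<F>" "X = trace -` \<G>" "\<H> \<subseteq> Pow \<F>" "Y = trace -` \<H>"
      unfolding \<A>_def by blast
    then have "X \<inter> Y = trace -` (\<G> \<inter> \<H>)" "\<G> \<inter> \<H> \<in> Pow (Pow \<F>)" by auto
    then show "X \<inter> Y \<in> \<A>" unfolding \<A>_def by blast
  qed
  moreover have "X \<in> \<A>" if "X \<in> \<F>" for X
  proof -
    have "X = trace -` {\<G> \<in> Pow \<F>. X \<in> \<G>}" using that by (auto simp: trace_def)
    then show ?thesis unfolding \<A>_def by blast
  qed
  ultimately show ?thesis by blast
qed

definition rainbow_on :: "('v, 'e) pre_digraph \<Rightarrow> nat \<Rightarrow> ('e \<Rightarrow> nat) \<Rightarrow> 'v set set \<Rightarrow> bool" where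
  "rainbow_on D k c \<A> \<longleftrightarrow>
     (\<forall>Y\<in>\<A>. absorbing D Y \<longrightarrow> card (entering D Y) = k \<longrightarrow> rainbow k c (entering D Y))"

text \<open>
  That \<open>contract X \<A> = \<A>\<close> says that \<open>X\<close> is an atom, so that as an absorbing set it is a
  sink of the quotient; if \<open>- X\<close> is an atom, it is a source. Distinct atoms are disjoint,
  so the stars of the sinks are disjoint, and so are those of the sources.
\<close>

lemma colouring_if_all_shores_trivial:
  assumes "k > 0" "finite \<A>"
    and trivial: "\<And>X. X \<in> \<A> \<Longrightarrow> absorbing D X \<Longrightarrow> card (entering D X) = k \<Longrightarrow>
                    contract X \<A> = \<A> \<or> contract (- X) \<A> = \<A>"
  shows "\<exists>c. range c \<subseteq> {..<k} \<and> rainbow_on D k c \<A>"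
proof -
  define M where "M = {X \<in> \<A>. absorbing D X \<and> card (entering D X) = k}"
  define \<S> where "\<S> = entering D ` {X \<in> M. contract X \<A> = \<A>}"
  define \<T> where "\<T> = entering D ` {X \<in> M. contract (- X) \<A> = \<A>}"
  have cards: "card B = k" if "B \<in> \<S> \<union> \<T>" for B
    using that unfolding \<S>_def \<T>_def M_def by auto
  have atom: "X \<inter> Y = {} \<or> X \<subseteq> Y" if "contract X \<A> = \<A>" "Y \<in> \<A>" for X Y
    using that unfolding contract_def by blast
  have "pairwise disjnt \<S>"
    unfolding \<S>_def
  proof (rule pairwise_imageI)
    fix X Y
    assume XY: "X \<in> {X \<in> M. contract X \<A> = \<A>}" "Y \<in> {X \<in> M. contract X \<A> = \<A>}"
      "entering D X \<noteq> entering D Y"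
    then have "X \<in> \<A>" "Y \<in> \<A>" "contract X \<A> = \<A>" "contract Y \<A> = \<A>" "X \<noteq> Y"
      by (auto simp: M_def)
    then have "X \<inter> Y = {}" using atom[of X Y] atom[of Y X] by fast
    then show "disjnt (entering D X) (entering D Y)"
      unfolding disjnt_def entering_def by blast
  qed
  moreover have "pairwise disjnt \<T>"
    unfolding \<T>_def
  proof (rule pairwise_imageI)
    fix X Y
    assume XY: "X \<in> {X \<in> M. contract (- X) \<A> = \<A>}" "Y \<in> {X \<in> M. contract (- X) \<A> = \<A>}"
      "entering D X \<noteq> entering D Y"
    then have "X \<in> \<A>" "Y \<in> \<A>" "contract (- X) \<A> = \<A>" "contract (- Y) \<A> = \<A>" "X \<noteq> Y"
      by (auto simp: M_def)
    then have "X \<union> Y = UNIV" using atom[of "- X" Y] atom[of "- Y" X] by fast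
    then show "disjnt (entering D X) (entering D Y)"
      unfolding disjnt_def entering_def by blast
  qed
  moreover have "finite \<S>" "finite \<T>"
    using assms(2) unfolding \<S>_def \<T>_def M_def by auto
  ultimately obtain c where c: "range c \<subseteq> {..<k}" "\<forall>B\<in>\<S> \<union> \<T>. inj_on c B"
    using colouring_two_disjoint_families[of \<S> \<T> k] cards \<open>k > 0\<close> card_ge_0_finite
    by (metis order_refl)
  have "rainbow k c (entering D X)" if "X \<in> M" for X
  proof -
    have "entering D X \<in> \<S> \<union> \<T>"
      using that trivial[of X] unfolding \<S>_def \<T>_def M_def by blast
    then show ?thesis using rainbow_of_inj_on c cards by blast
  qed
  then show ?thesis using c(1) unfolding rainbow_on_def M_def by blast
qed

text \<open>
  The permutation \<open>\<sigma>\<close> renames the colours of \<open>c\<^sub>2\<close> so that both colourings agree on the dicut of \<open>X\<close>.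
  Arcs inside \<open>X\<close> then follow \<open>c\<^sub>2\<close> and all others follow \<open>c\<^sub>1\<close>. In an absorbing set \<open>X\<close> an arc lies
  inside \<open>X\<close> as soon as its tail does.
\<close>

lemma glue_colourings:
  assumes X: "absorbing D X" "rainbow k c\<^sub>1 (entering D X)" "rainbow k c\<^sub>2 (entering D X)"
    and range: "range c\<^sub>1 \<subseteq> {..<k}" "range c\<^sub>2 \<subseteq> {..<k}"
    and outside: "rainbow_on D k c\<^sub>1 (contract X \<A>)"
    and inside: "rainbow_on D k c\<^sub>2 (contract (- X) \<A>)"
  shows "\<exists>c. range c \<subseteq> {..<k} \<and> rainbow_on D k c (contract X \<A> \<union> contract (- X) \<A>)"
proof -
  define \<sigma> where "\<sigma> = c\<^sub>1 \<circ> inv_into (entering D X) c\<^sub>2"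
  have \<sigma>: "bij_betw \<sigma> {..<k} {..<k}"
    using X(2,3) unfolding \<sigma>_def rainbow_def by (meson bij_betw_inv_into bij_betw_trans)
  have agree: "\<sigma> (c\<^sub>2 e) = c\<^sub>1 e" if "e \<in> entering D X" for e
    using X(3) that unfolding \<sigma>_def rainbow_def bij_betw_def by simp
  define c where "c e = (if tail D e \<in> X then \<sigma> (c\<^sub>2 e) else c\<^sub>1 e)" for e
  have "\<sigma> (c\<^sub>2 e) < k" for e
  proof -
    have "c\<^sub>2 e \<in> {..<k}" using range(2) by blast
    then show ?thesis using \<sigma> bij_betwE by blast
  qed
  then have "range c \<subseteq> {..<k}"
    using range(1) unfolding c_def by auto
  moreover have "rainbow k c (entering D Y)"
    if Y: "Y \<in> contract X \<A>" "absorbing D Y" "card (entering D Y) = k" for Y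
  proof -
    have "c e = c\<^sub>1 e" if "e \<in> entering D Y" for e
      using that Y(1) X(1) unfolding c_def entering_def contract_def absorbing_def by auto
    moreover have "rainbow k c\<^sub>1 (entering D Y)" using outside Y unfolding rainbow_on_def by blast
    ultimately show ?thesis unfolding rainbow_def using bij_betw_cong by metis
  qed
  moreover have "rainbow k c (entering D Y)"
    if Y: "Y \<in> contract (- X) \<A>" "absorbing D Y" "card (entering D Y) = k" for Y
  proof -
    have "c e = (\<sigma> \<circ> c\<^sub>2) e" if e: "e \<in> entering D Y" for e
    proof (cases "tail D e \<in> X")
      case True
      then show ?thesis by (simp add: c_def)
    next
      case False
      then have "e \<in> entering D X" using e Y(1) unfolding entering_def contract_def by blast
      then show ?thesis using agree False by (simp add: c_def)
    qed
    moreover have "bij_betw (\<sigma> \<circ> c\<^sub>2) (entering D Y) {..<k}"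
      using inside Y \<sigma> bij_betw_trans unfolding rainbow_on_def rainbow_def by blast
    ultimately show ?thesis unfolding rainbow_def using bij_betw_cong by metis
  qed
  ultimately show ?thesis unfolding rainbow_on_def by blast
qed

text \<open>
  The uncrossing step. The sizes of the dicuts of \<open>X \<inter> Y\<close> and \<open>X \<union> Y\<close> add up to \<open>2 * k\<close>. If both
  are non-empty, both are minimum dicuts, and they are rainbow because their shores are nested with \<open>X\<close>.
  Modularity for each colour class then determines the number of its arcs entering \<open>Y\<close>.
\<close>

lemma rainbow_on_crossing:
  assumes alg: "set_algebra \<A>" and "k > 0"
    and least: "\<And>Z. \<lbrakk>absorbing D Z; entering D Z \<noteq> {}; finite (entering D Z)\<rbrakk>
                  \<Longrightarrow> k \<le> card (entering D Z)"
    and X: "X \<in> \<A>" "absorbing D X" "card (entering D X) = k"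
    and c: "rainbow_on D k c (contract X \<A> \<union> contract (- X) \<A>)"
  shows "rainbow_on D k c \<A>"
  unfolding rainbow_on_def
proof (intro ballI impI)
  fix Y assume Y: "Y \<in> \<A>" "absorbing D Y" "card (entering D Y) = k"
  have fin: "finite (entering D X)" "finite (entering D Y)"
    using X(3) Y(3) \<open>k > 0\<close> card_ge_0_finite by metis+
  have nested: "rainbow k c (entering D Z)"
    if "Z \<in> \<A>" "absorbing D Z" "card (entering D Z) = k"
      "X \<inter> Z = {} \<or> X \<subseteq> Z \<or> Z \<subseteq> X \<or> X \<union> Z = UNIV" for Z
  proof -
    have "Z \<in> contract X \<A> \<union> contract (- X) \<A>" using that(1,4) unfolding contract_def by blast
    then show ?thesis using c that(2,3) unfolding rainbow_on_def by blast
  qed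
  note XY = absorbing_Int[OF X(2) Y(2)] absorbing_Un[OF X(2) Y(2)]
  note modular = card_entering_modular[OF X(2) Y(2) fin]
  have finXY: "finite (entering D (X \<inter> Y))" "finite (entering D (X \<union> Y))"
    using entering_uncross(1)[OF X(2) Y(2)] fin by (metis finite_Un)+
  consider "entering D (X \<inter> Y) = {}" | "entering D (X \<union> Y) = {}"
    | "entering D (X \<inter> Y) \<noteq> {}" "entering D (X \<union> Y) \<noteq> {}" by blast
  then show "rainbow k c (entering D Y)"
  proof cases
    case 1
    then show ?thesis
      using nested[of "Y - X"] detach_Int[OF X(2) Y(2)] Y(3) set_algebraD(4)[OF alg Y(1) X(1)]
      by (metis Diff_disjoint)
  next
    case 2
    have "Y \<union> - X \<in> \<A>" using set_algebraD(1,3)[OF alg] X(1) Y(1) by blast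
    moreover have "X \<union> (Y \<union> - X) = UNIV" by blast
    ultimately show ?thesis
      using nested[of "Y \<union> - X"] detach_Un[OF X(2) Y(2) 2] Y(3) by metis
  next
    case 3
    have "k \<le> card (entering D (X \<inter> Y))" "k \<le> card (entering D (X \<union> Y))"
      using least[OF XY(1)] least[OF XY(2)] 3 finXY by auto
    then have k: "card (entering D (X \<inter> Y)) = k" "card (entering D (X \<union> Y)) = k"
      using modular[of UNIV] X(3) Y(3) by auto
    have "rainbow k c (entering D X)" using nested[OF X] by blast
    moreover have "rainbow k c (entering D (X \<inter> Y))"
      using nested[OF set_algebraD(2)[OF alg X(1) Y(1)] XY(1) k(1)] by blast
    moreover have "rainbow k c (entering D (X \<union> Y))"
      using nested[OF set_algebraD(3)[OF alg X(1) Y(1)] XY(2) k(2)] by blast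
    ultimately have "\<forall>i<k. card (entering D Y \<inter> c -` {i}) = 1"
      using rainbow_iff_card_fibres fin finXY k X(3) modular by (metis add_left_cancel)
    then show ?thesis using rainbow_iff_card_fibres[OF fin(2) Y(3)] by blast
  qed
qed

lemma colouring_finite_algebra:
  assumes "k > 0"
    and least: "\<And>Z. \<lbrakk>absorbing D Z; entering D Z \<noteq> {}; finite (entering D Z)\<rbrakk>
                  \<Longrightarrow> k \<le> card (entering D Z)"
    and "finite \<A>" "set_algebra \<A>"
  shows "\<exists>c. range c \<subseteq> {..<k} \<and> rainbow_on D k c \<A>"
  using assms(3,4)
proof (induction \<A> rule: finite_psubset_induct)
  case (psubset \<A>)
  show ?case
  proof (cases "\<forall>X\<in>\<A>. absorbing D X \<longrightarrow> card (entering D X) = k \<longrightarrow>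
                    contract X \<A> = \<A> \<or> contract (- X) \<A> = \<A>")
    case True
    then show ?thesis
      using colouring_if_all_shores_trivial[OF \<open>k > 0\<close> psubset.hyps] by blast
  next
    case False
    then obtain X where X: "X \<in> \<A>" "absorbing D X" "card (entering D X) = k"
      and strict: "contract X \<A> \<noteq> \<A>" "contract (- X) \<A> \<noteq> \<A>" by blast
    have "contract X \<A> \<subset> \<A>" "contract (- X) \<A> \<subset> \<A>"
      using strict unfolding contract_def by blast+
    then obtain c\<^sub>1 c\<^sub>2 where c: "range c\<^sub>1 \<subseteq> {..<k}" "rainbow_on D k c\<^sub>1 (contract X \<A>)"
      "range c\<^sub>2 \<subseteq> {..<k}" "rainbow_on D k c\<^sub>2 (contract (- X) \<A>)"
      using psubset.IH set_algebra_contract[OF psubset.prems] by meson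
    have "X \<in> contract X \<A>" "X \<in> contract (- X) \<A>" using X(1) unfolding contract_def by auto
    then have "rainbow k c\<^sub>1 (entering D X)" "rainbow k c\<^sub>2 (entering D X)"
      using c X unfolding rainbow_on_def by blast+
    then obtain c where "range c \<subseteq> {..<k}"
      "rainbow_on D k c (contract X \<A> \<union> contract (- X) \<A>)"
      using glue_colourings[OF X(2)] c by meson
    then show ?thesis
      using rainbow_on_crossing[OF psubset.prems \<open>k > 0\<close> least X] by blast
  qed
qed

section \<open>Compactness\<close>

text \<open>
  Colourings with \<open>k\<close> colours form a compact product of finite discrete spaces, and being injective on a
  set is a closed condition, as a clash of two elements is visible in two coordinates.
\<close>

lemma colouring_compactness:
  fixes \<B> :: "'e set set" and k :: nat
  assumes finite_sub: "\<And>\<F>. finite \<F> \<Longrightarrow> \<F> \<subseteq> \<B> \<Longrightarrow>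
             \<exists>c. range c \<subseteq> {..<k} \<and> (\<forall>B\<in>\<F>. inj_on c B)"
  shows "\<exists>c. range c \<subseteq> {..<k} \<and> (\<forall>B\<in>\<B>. inj_on c B)"
proof -
  define T where "T = product_topology (\<lambda>_ :: 'e. discrete_topology {..<k}) UNIV"
  define G where "G B = {c \<in> topspace T. inj_on c B}" for B
  have space: "topspace T = {c. range c \<subseteq> {..<k}}"
    by (auto simp: T_def PiE_def)
  have compact: "compact_space T"
    unfolding T_def
    by (simp add: compact_space_product_topology compact_space_discrete_topology)
  have open_fibre: "openin T {c \<in> topspace T. c e \<in> {i}}" if "i < k" for e i
    using that unfolding T_def
    by (intro openin_continuous_map_preimage[OF continuous_map_product_projection]) auto
  have closed: "closedin T (G B)" for B
  proof -
    define clash where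
      "clash e f i = {c \<in> topspace T. c e \<in> {i}} \<inter> {c \<in> topspace T. c f \<in> {i}}" for e f i
    define K where "K = {clash e f i | e f i. e \<in> B \<and> f \<in> B \<and> e \<noteq> f \<and> i < k}"
    have "topspace T - G B = \<Union>K"
    proof (intro equalityI subsetI)
      fix c assume "c \<in> topspace T - G B"
      then obtain e f where "c \<in> topspace T" "e \<in> B" "f \<in> B" "e \<noteq> f" "c e = c f"
        unfolding G_def inj_on_def by blast
      moreover from this have "c e < k" unfolding space by auto
      ultimately have "c \<in> clash e f (c e)" "clash e f (c e) \<in> K"
        unfolding clash_def K_def by auto
      then show "c \<in> \<Union>K" by blast
    next
      fix c assume "c \<in> \<Union>K"
      then show "c \<in> topspace T - G B"
        unfolding K_def clash_def G_def by (auto dest: inj_onD)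
    qed
    moreover have "openin T (\<Union>K)"
    proof (rule openin_Union)
      fix U assume "U \<in> K"
      then show "openin T U" using open_fibre unfolding K_def clash_def by blast
    qed
    ultimately show ?thesis by (auto simp: closedin_def G_def)
  qed
  have fip: "\<Inter>\<U> \<noteq> {}"
    if "\<forall>C\<in>\<U>. closedin T C" "\<forall>\<C>. finite \<C> \<and> \<C> \<subseteq> \<U> \<longrightarrow> \<Inter>\<C> \<noteq> {}" for \<U>
    using compact[unfolded compact_space_fip, THEN spec[of _ \<U>], THEN mp, OF conjI, OF that] .
  \<comment> \<open>The whole space is added so that the intersection consists of colourings even if \<open>\<B>\<close> is empty.\<close>
  have "\<Inter>(insert (topspace T) (G ` \<B>)) \<noteq> {}"
  proof (rule fip)
    show "\<forall>C\<in>insert (topspace T) (G ` \<B>). closedin T C"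
      using closed by simp
  next
    show "\<forall>\<C>. finite \<C> \<and> \<C> \<subseteq> insert (topspace T) (G ` \<B>) \<longrightarrow> \<Inter>\<C> \<noteq> {}"
    proof (intro allI impI)
      fix \<C> assume "finite \<C> \<and> \<C> \<subseteq> insert (topspace T) (G ` \<B>)"
      then have fin: "finite (\<C> - {topspace T})" and sub: "\<C> - {topspace T} \<subseteq> G ` \<B>" by auto
      obtain \<F> where \<F>: "\<F> \<subseteq> \<B>" "finite \<F>" "\<C> - {topspace T} = G ` \<F>"
        using finite_subset_image[OF fin sub] by blast
      obtain c where "range c \<subseteq> {..<k}" "\<forall>B\<in>\<F>. inj_on c B"
        using finite_sub[OF \<F>(2,1)] by blast
      then have "c \<in> topspace T" "\<forall>C\<in>\<C> - {topspace T}. c \<in> C"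
        unfolding \<F>(3) by (simp_all add: G_def space)
      then have "\<forall>C\<in>\<C>. c \<in> C" by (metis DiffI singletonD)
      then show "\<Inter>\<C> \<noteq> {}" by (metis InterI empty_iff)
    qed
  qed
  then obtain c where "c \<in> topspace T" "\<forall>B\<in>\<B>. c \<in> G B" by auto
  then have "range c \<subseteq> {..<k}" "\<forall>B\<in>\<B>. inj_on c B" by (simp_all add: G_def space)
  then show ?thesis by (intro exI[of _ c] conjI)
qed

section \<open>Minimum dicuts and their dijoins\<close>

lemma colouring_min_dicuts:
  assumes "wf_digraph D" "k > 0"
    and least: "\<And>B. \<lbrakk>dicut D B; B \<noteq> {}; finite B\<rbrakk> \<Longrightarrow> k \<le> card B"
  shows "\<exists>c. range c \<subseteq> {..<k} \<and> (\<forall>B. dicut D B \<longrightarrow> card B = k \<longrightarrow> inj_on c B)"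
proof -
  note iff = nonempty_dicut_iff[OF assms(1)]
  have least': "k \<le> card (entering D Z)"
    if "absorbing D Z" "entering D Z \<noteq> {}" "finite (entering D Z)" for Z
    using least that iff by blast
  have "\<exists>c. range c \<subseteq> {..<k} \<and> (\<forall>B\<in>\<F>. inj_on c B)"
    if \<F>: "finite \<F>" "\<F> \<subseteq> {B. dicut D B \<and> card B = k}" for \<F>
  proof -
    have "\<exists>X. absorbing D X \<and> B = entering D X" if "B \<in> \<F>" for B
    proof -
      have "dicut D B" "B \<noteq> {}" using that \<F>(2) \<open>k > 0\<close> by auto
      then show ?thesis using iff by blast
    qed
    then obtain shore where shore: "\<And>B. B \<in> \<F> \<Longrightarrow> absorbing D (shore B) \<and> B = entering D (shore B)"
      by metis
    obtain \<A> where \<A>: "finite \<A>" "set_algebra \<A>" "shore ` \<F> \<subseteq> \<A>"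
      using finite_set_algebra_containing \<F>(1) by blast
    obtain c where c: "range c \<subseteq> {..<k}" "rainbow_on D k c \<A>"
      using colouring_finite_algebra[OF \<open>k > 0\<close> least' \<A>(1,2)] by blast
    have "inj_on c B" if "B \<in> \<F>" for B
    proof -
      have "shore B \<in> \<A>" "card B = k" using \<A>(3) \<F>(2) that by auto
      then have "rainbow k c B" using c(2) shore[OF that] unfolding rainbow_on_def by metis
      then show ?thesis unfolding rainbow_def bij_betw_def by simp
    qed
    then show ?thesis using c(1) by blast
  qed
  from colouring_compactness[of "{B. dicut D B \<and> card B = k}" k, OF this]
  show ?thesis by blast
qed

text \<open>
  Disjoint dijoins meet \<open>B\<close> in distinct arcs.
\<close>

lemma disjoint_dijoins_lepoll:
  assumes "disjoint_dijoins D \<BB> \<J>" "B \<in> \<BB>"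
  shows "\<J> \<lesssim> B"
proof -
  have "\<forall>J\<in>\<J>. \<exists>e. e \<in> J \<inter> B"
    using assms unfolding disjoint_dijoins_def dijoin_def by blast
  then obtain f where f: "\<And>J. J \<in> \<J> \<Longrightarrow> f J \<in> J \<inter> B" by metis
  have "inj_on f \<J>"
  proof (rule inj_onI)
    fix J J' assume *: "J \<in> \<J>" "J' \<in> \<J>" "f J = f J'"
    then have "\<not> disjnt J J'" using f[of J] f[of J'] unfolding disjnt_def by auto
    then show "J = J'" using assms(1) * unfolding disjoint_dijoins_def pairwise_def by blast
  qed
  then show ?thesis using f unfolding lepoll_def by blast
qed

theorem theorem4:
  fixes D :: "('v, 'e) pre_digraph"
  assumes "loopfree_digraph D"
    and "\<exists>B. dicut D B \<and> B \<noteq> {} \<and> finite B"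
  shows "(\<exists>B. B \<in> min_dicuts D) \<and>
         (\<exists>\<J>. largest_disjoint_dijoins D (min_dicuts D) \<J>) \<and>
         (\<forall>B \<J>. B \<in> min_dicuts D \<longrightarrow> largest_disjoint_dijoins D (min_dicuts D) \<J> \<longrightarrow> B \<approx> \<J>)"
proof -
  have wf: "wf_digraph D" using assms(1) by (simp add: loopfree_digraph_def)
  obtain B\<^sub>0 where B\<^sub>0: "dicut D B\<^sub>0 \<and> B\<^sub>0 \<noteq> {} \<and> finite B\<^sub>0"
    and arg_min: "\<And>B. dicut D B \<and> B \<noteq> {} \<and> finite B \<Longrightarrow> card B\<^sub>0 \<le> card B"
    using exists_least_iff[of "\<lambda>n. \<exists>B. (dicut D B \<and> B \<noteq> {} \<and> finite B) \<and> card B = n"] assms(2)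
    by (metis not_less)
  define k where "k = card B\<^sub>0"
  have "k > 0" using B\<^sub>0 by (simp add: k_def card_gt_0_iff)
  have least: "k \<le> card B" if "dicut D B" "B \<noteq> {}" "finite B" for B
    using arg_min that unfolding k_def by blast
  have "B\<^sub>0 \<lesssim> B" if "dicut D B" "B \<noteq> {}" for B
  proof (cases "finite B")
    case True
    then show ?thesis using arg_min that B\<^sub>0 by (simp add: lepoll_iff_card_le)
  next
    case False
    then show ?thesis using B\<^sub>0 finite_lepoll_infinite by blast
  qed
  then have B\<^sub>0_min: "B\<^sub>0 \<in> min_dicuts D" using B\<^sub>0 unfolding min_dicuts_def by blast
  have min_eqpoll: "B \<approx> B\<^sub>0" if "B \<in> min_dicuts D" for B
    using that B\<^sub>0_min unfolding min_dicuts_def by (simp add: lepoll_antisym)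
  obtain c where c: "range c \<subseteq> {..<k}" "\<And>B. dicut D B \<Longrightarrow> card B = k \<Longrightarrow> inj_on c B"
    using colouring_min_dicuts[OF wf \<open>k > 0\<close>] least by metis
  have onto: "c ` B = {..<k}" if B: "B \<in> min_dicuts D" for B
  proof -
    have "finite B" "card B = k"
      using min_eqpoll[OF B] B\<^sub>0 eqpoll_finite_iff eqpoll_iff_card unfolding k_def by blast+
    then have "inj_on c B" using c(2) B unfolding min_dicuts_def by blast
    then show ?thesis
      using rainbow_of_inj_on \<open>card B = k\<close> c(1) unfolding rainbow_def bij_betw_def by blast
  qed
  define J where "J i = {e \<in> arcs D. c e = i}" for i
  have meets: "J i \<inter> B \<noteq> {}" if "i < k" "B \<in> min_dicuts D" for i B
  proof -
    have "B \<subseteq> arcs D" using that(2) unfolding min_dicuts_def dicut_def edges_between_def by blast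
    moreover have "i \<in> c ` B" using onto[OF that(2)] that(1) by simp
    ultimately show ?thesis unfolding J_def by blast
  qed
  then have dj: "disjoint_dijoins D (min_dicuts D) (J ` {..<k})"
    unfolding disjoint_dijoins_def dijoin_def pairwise_def disjnt_def J_def by auto
  have "inj_on J {..<k}"
    using meets B\<^sub>0_min unfolding inj_on_def J_def by blast
  then have "J ` {..<k} \<approx> {..<k}" by (meson eqpoll_sym inj_on_image_eqpoll_self)
  also have "{..<k} \<approx> B\<^sub>0" using B\<^sub>0 by (simp add: eqpoll_iff_card k_def)
  finally have size: "J ` {..<k} \<approx> B\<^sub>0" .
  have bound: "\<J> \<lesssim> J ` {..<k}" if "disjoint_dijoins D (min_dicuts D) \<J>" for \<J>
    using disjoint_dijoins_lepoll[OF that B\<^sub>0_min] size eqpoll_sym lepoll_trans2 by blast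
  have largest: "largest_disjoint_dijoins D (min_dicuts D) (J ` {..<k})"
    using dj bound unfolding largest_disjoint_dijoins_def by blast
  have "B \<approx> \<J>" if "B \<in> min_dicuts D" "largest_disjoint_dijoins D (min_dicuts D) \<J>" for B \<J>
  proof -
    have "\<J> \<approx> J ` {..<k}"
      using that(2) bound dj lepoll_antisym unfolding largest_disjoint_dijoins_def by blast
    then show ?thesis using min_eqpoll[OF that(1)] size eqpoll_trans eqpoll_sym by metis
  qed
  then show ?thesis using B\<^sub>0_min largest by blast
qed

end
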